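(* Let $T$ be a triangle in a Minkowski plane $(\mathbb{R}^2,\|\cdot\|)$. If $T$ possesses a circumcenter $M$ in the relative interior of its medial triangle, then $M$ is the unique circumcenter of $T$. In particular, if the centroid $G$ of $T$ is a circumcenter of $T$, then $T$ possesses no other circumcenter besides $G$.
   Context: A Minkowski plane is $\mathbb{R}^2$ equipped with an arbitrary norm $\|\cdot\|$. A circumcenter of a triangle $T$ is the center $M$ of a Minkowskian circle $\{Y:\|Y-M\|=r\}$ ($r>0$) containing all three vertices of $T$. The medial triangle of $T$ is the triangle whose vertices are the midpoints of the sides of $T$. The centroid of a triangle with vertices $A_0,A_1,A_2$ is $(A_0+A_1+A_2)/3$. *)

theory Defs
  imports "HOL-Analysis.Analysis"
begin

text \<open>
  The norm of a Minkowski plane is an arbitrary function \<open>N\<close> on \<open>real^2\<close> satisfying the norm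
  axioms. The class operation \<open>norm\<close> on \<open>real^2\<close> is fixed to the Euclidean norm, so it cannot
  be used here.
\<close>

definition is_norm :: "('a::real_vector \<Rightarrow> real) \<Rightarrow> bool" where
  "is_norm N \<longleftrightarrow>
     (\<forall>x. 0 \<le> N x) \<and>
     (\<forall>x. N x = 0 \<longleftrightarrow> x = 0) \<and>
     (\<forall>a x. N (a *\<^sub>R x) = \<bar>a\<bar> * N x) \<and>
     (\<forall>x y. N (x + y) \<le> N x + N y)"

definition mcircle :: "('a::real_vector \<Rightarrow> real) \<Rightarrow> 'a \<Rightarrow> real \<Rightarrow> 'a set" where
  "mcircle N M r = {Y. N (Y - M) = r}"

text \<open>Triangles are given by their vertices.\<close>

definition is_triangle :: "real^2 \<Rightarrow> real^2 \<Rightarrow> real^2 \<Rightarrow> bool" where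
  "is_triangle A B C \<longleftrightarrow> \<not> collinear {A, B, C}"

definition is_circumcenter ::
  "(real^2 \<Rightarrow> real) \<Rightarrow> real^2 \<Rightarrow> real^2 \<Rightarrow> real^2 \<Rightarrow> real^2 \<Rightarrow> bool" where
  "is_circumcenter N A B C M \<longleftrightarrow> (\<exists>r>0. {A, B, C} \<subseteq> mcircle N M r)"

definition medial_triangle :: "real^2 \<Rightarrow> real^2 \<Rightarrow> real^2 \<Rightarrow> (real^2) set" where
  "medial_triangle A B C = convex hull {midpoint B C, midpoint C A, midpoint A B}"

definition centroid :: "real^2 \<Rightarrow> real^2 \<Rightarrow> real^2 \<Rightarrow> real^2" where
  "centroid A B C = (1/3) *\<^sub>R (A + B + C)"

end

theory Submission
  imports Defs
begin

text \<open>
  Write \<open>a, b, c\<close> for the vertices relative to the circumcenter \<open>M\<close>, let \<open>r\<close> be the radius, and let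
  \<open>s\<close> be the radius for another circumcenter \<open>M + x\<close>. That \<open>M\<close> lies inside the medial triangle means
  \<open>\<alpha> a + \<beta> b + \<gamma> c = 0\<close> with weights in \<open>(0, 1/2)\<close> of sum 1. Hence \<open>-c\<close> lies strictly beyond the line
  \<open>ab\<close>, so no supporting line of the ball contains two of the vertices.
  Because of this relation, \<open>x = \<delta>\<^sub>1 a + \<delta>\<^sub>2 b + \<delta>\<^sub>3 c\<close> with coefficients whose sum may be prescribed; the
  choice \<open>(r - s) / r\<close> makes them the signed weights that relate the two homothetic inscribed triangles.
  A supporting functional at \<open>a\<close> shows that \<open>\<delta>\<^sub>2, \<delta>\<^sub>3 \<ge> 0\<close> forces \<open>\<delta>\<^sub>2 = \<delta>\<^sub>3 = 0\<close>, and one at \<open>a - x\<close> shows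
  that \<open>\<delta>\<^sub>2 < 0\<close>, \<open>\<delta>\<^sub>3 \<le> 0\<close> is impossible. Applied to all vertices this leaves only \<open>x = 0\<close>.
\<close>

section \<open>Norm axioms and supporting functionals\<close>

lemma is_norm_zero: "is_norm N \<Longrightarrow> N 0 = 0"
  by (simp add: is_norm_def)

lemma is_norm_nonneg: "is_norm N \<Longrightarrow> 0 \<le> N x"
  by (simp add: is_norm_def)

lemma is_norm_scaleR: "is_norm N \<Longrightarrow> N (t *\<^sub>R x) = \<bar>t\<bar> * N x"
  by (simp add: is_norm_def)

lemma is_norm_triangle: "is_norm N \<Longrightarrow> N (x + y) \<le> N x + N y"
  by (simp add: is_norm_def)

lemma is_norm_uminus: "is_norm N \<Longrightarrow> N (- x) = N x"
  using is_norm_scaleR[of N "-1" x] by simp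

lemma is_norm_pos: "is_norm N \<Longrightarrow> x \<noteq> 0 \<Longrightarrow> 0 < N x"
  by (metis is_norm_def order_le_less)

lemma convex_norm_ball:
  assumes N: "is_norm N"
  shows "convex {x. N x < k}"
proof (rule convexI)
  fix x y and u v :: real
  assume xy: "x \<in> {x. N x < k}" "y \<in> {x. N x < k}" and uv: "0 \<le> u" "0 \<le> v" "u + v = 1"
  have "N (u *\<^sub>R x + v *\<^sub>R y) \<le> u * N x + v * N y"
    using is_norm_triangle[OF N, of "u *\<^sub>R x" "v *\<^sub>R y"] uv by (simp add: is_norm_scaleR[OF N])
  also have "\<dots> < k"
    using convex_bound_lt[of "N x" k "N y" u v] xy uv by simp
  finally show "u *\<^sub>R x + v *\<^sub>R y \<in> {x. N x < k}" by simp
qed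

text \<open>Finite-dimensional Hahn-Banach: a hyperplane separates \<open>p\<close> from the open
  ball of radius \<open>N p\<close>, and its normal \<open>v\<close> is rescaled to take the value
  \<open>N p\<close> at \<open>p\<close>.\<close>

lemma supporting_functional:
  fixes N :: "'a::euclidean_space \<Rightarrow> real"
  assumes N: "is_norm N"
  obtains w where "w \<bullet> p = N p" and "\<And>y. w \<bullet> y \<le> N y"
proof (cases "p = 0")
  case True
  show ?thesis
    by (rule that[of 0]) (use True N in \<open>auto simp: is_norm_zero is_norm_nonneg\<close>)
next
  case False
  then have p: "0 < N p" by (rule is_norm_pos[OF N])
  let ?S = "{x. N x < N p}"
  have "0 \<in> ?S" using p by (simp add: is_norm_zero[OF N])
  then obtain v k where v: "v \<noteq> 0" and le: "\<forall>x\<in>?S. v \<bullet> x \<le> k" and ge: "\<forall>x\<in>{p}. k \<le> v \<bullet> x"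
    using separating_hyperplane_sets[of ?S "{p}"] convex_norm_ball[OF N] by blast
  \<comment> \<open>Separation only speaks of the open ball, so \<open>y\<close> is scaled into it
    with some \<open>l\<close> strictly above \<open>N y\<close>; letting \<open>l\<close> decrease
    to \<open>N y\<close> then gives \<open>below'\<close>.\<close>
  have below: "N p * (v \<bullet> y) \<le> (v \<bullet> p) * l" if "N y < l" for y l
  proof -
    have l: "0 < l" using that is_norm_nonneg[OF N, of y] by linarith
    have "N ((N p / l) *\<^sub>R y) = N p * (N y / l)"
      using l p by (simp add: is_norm_scaleR[OF N])
    also have "\<dots> < N p" using that l p by (simp add: pos_divide_less_eq)
    finally have "v \<bullet> ((N p / l) *\<^sub>R y) \<le> v \<bullet> p" using le ge by fastforce
    then show ?thesis using l by (simp add: field_simps)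
  qed
  have below': "N p * (v \<bullet> y) \<le> (v \<bullet> p) * N y" for y
  proof (rule tendsto_lowerbound)
    show "((\<lambda>l. (v \<bullet> p) * l) \<longlongrightarrow> (v \<bullet> p) * N y) (at_right (N y))"
      by (intro tendsto_intros)
    show "\<forall>\<^sub>F l in at_right (N y). N p * (v \<bullet> y) \<le> (v \<bullet> p) * l"
      using below by (auto simp: eventually_at_filter)
  qed simp
  \<comment> \<open>Testing the bound at \<open>v\<close> itself shows that the later division by
    \<open>v \<bullet> p\<close> is by a positive number.\<close>
  have "0 < N p * (v \<bullet> v)" using v p by simp
  also have "\<dots> \<le> (v \<bullet> p) * N v" by (rule below')
  finally have vp: "0 < v \<bullet> p"
    using is_norm_nonneg[OF N, of v] by (simp add: zero_less_mult_iff)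
  show ?thesis
  proof (rule that)
    show "((N p / (v \<bullet> p)) *\<^sub>R v) \<bullet> p = N p" using vp by simp
    show "((N p / (v \<bullet> p)) *\<^sub>R v) \<bullet> y \<le> N y" for y
      using below'[of y] vp by (simp add: field_simps)
  qed
qed

section \<open>Supporting functionals at the vertices\<close>

lemma support_at_most_one_vertex:
  fixes N :: "'a::euclidean_space \<Rightarrow> real"
  assumes N: "is_norm N" and r: "0 < r" "N c \<le> r"
    and bary: "\<alpha> *\<^sub>R a + \<beta> *\<^sub>R b + \<gamma> *\<^sub>R c = 0" "\<alpha> + \<beta> + \<gamma> = 1" "0 < \<gamma>" "\<gamma> < 1/2"
    and w: "\<And>y. w \<bullet> y \<le> N y" and a: "w \<bullet> a = r"
  shows "w \<bullet> b \<noteq> r"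
proof
  assume b: "w \<bullet> b = r"
  have "\<alpha> * (w \<bullet> a) + \<beta> * (w \<bullet> b) + \<gamma> * (w \<bullet> c) = 0"
    using arg_cong[OF bary(1), of "inner w"] by (simp add: inner_add_right)
  \<comment> \<open>If \<open>w\<close> equals \<open>r\<close> along the line \<open>ab\<close>,
    then at \<open>- c\<close> it equals \<open>(\<alpha> + \<beta>) / \<gamma>\<close> times
    \<open>r\<close>. This factor exceeds 1 because \<open>\<gamma> < 1/2\<close>, while
    \<open>w\<close> is at most \<open>r\<close> there.\<close>
  then have "(\<alpha> + \<beta>) * r = \<gamma> * (w \<bullet> - c)"
    using a b by (simp add: algebra_simps)
  also have "\<dots> \<le> \<gamma> * r"
    using w[of "- c"] r(2) bary(3) by (intro mult_left_mono) (simp_all add: is_norm_uminus[OF N])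
  finally have "\<alpha> + \<beta> \<le> \<gamma>" using r by simp
  then show False using bary by linarith
qed

lemma support_at_vertex:
  fixes N :: "'a::euclidean_space \<Rightarrow> real"
  assumes N: "is_norm N" and r: "0 < r" and a: "N a = r" and b: "N b = r" and c: "N c = r"
    and bary: "\<alpha> *\<^sub>R a + \<beta> *\<^sub>R b + \<gamma> *\<^sub>R c = 0" "\<alpha> + \<beta> + \<gamma> = 1"
      "0 < \<beta>" "\<beta> < 1/2" "0 < \<gamma>" "\<gamma> < 1/2"
    and x: "x = \<delta>\<^sub>1 *\<^sub>R a + \<delta>\<^sub>2 *\<^sub>R b + \<delta>\<^sub>3 *\<^sub>R c" "(\<delta>\<^sub>1 + \<delta>\<^sub>2 + \<delta>\<^sub>3) * r = r - s"
    and ax: "N (a - x) \<le> s"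
    and nonneg: "0 \<le> \<delta>\<^sub>2" "0 \<le> \<delta>\<^sub>3"
  shows "\<delta>\<^sub>2 = 0 \<and> \<delta>\<^sub>3 = 0"
proof -
  obtain w where wa: "w \<bullet> a = r" and w: "\<And>y. w \<bullet> y \<le> N y"
    using supporting_functional[OF N, of a] a by metis
  have wb: "w \<bullet> b < r"
    using support_at_most_one_vertex[OF N r _ bary(1,2,5,6) w wa] w[of b] b c by fastforce
  have "\<alpha> *\<^sub>R a + \<gamma> *\<^sub>R c + \<beta> *\<^sub>R b = 0" "\<alpha> + \<gamma> + \<beta> = 1"
    using bary(1,2) by (simp_all add: algebra_simps)
  then have wc: "w \<bullet> c < r"
    using support_at_most_one_vertex[OF N r _ _ _ bary(3,4) w wa, where b = c] w[of c] b c by fastforce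
  have "w \<bullet> (a - x) \<le> s" using w ax order_trans by blast
  \<comment> \<open>The prescribed coefficient sum eliminates \<open>\<delta>\<^sub>1\<close> and
    cancels \<open>r - s\<close>; only the strict gaps at \<open>b\<close> and \<open>c\<close>
    remain.\<close>
  then have "\<delta>\<^sub>2 * (r - w \<bullet> b) + \<delta>\<^sub>3 * (r - w \<bullet> c) \<le> 0"
    using x wa by (simp add: inner_add_right inner_diff_right algebra_simps)
  moreover have "0 \<le> \<delta>\<^sub>2 * (r - w \<bullet> b)" "0 \<le> \<delta>\<^sub>3 * (r - w \<bullet> c)"
    using nonneg wb wc by simp_all
  ultimately have "\<delta>\<^sub>2 * (r - w \<bullet> b) = 0" "\<delta>\<^sub>3 * (r - w \<bullet> c) = 0" by linarith+
  then show ?thesis using wb wc by simp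
qed

lemma support_at_shifted_vertex:
  fixes N :: "'a::euclidean_space \<Rightarrow> real"
  assumes N: "is_norm N" and r: "0 < r" and s: "0 < s" and a: "N a \<le> r" and c: "N c \<le> r"
    and bary: "\<alpha> *\<^sub>R a + \<beta> *\<^sub>R b + \<gamma> *\<^sub>R c = 0" "\<alpha> + \<beta> + \<gamma> = 1" "0 < \<gamma>" "\<gamma> < 1/2"
    and x: "x = \<delta>\<^sub>1 *\<^sub>R a + \<delta>\<^sub>2 *\<^sub>R b + \<delta>\<^sub>3 *\<^sub>R c" "(\<delta>\<^sub>1 + \<delta>\<^sub>2 + \<delta>\<^sub>3) * r = r - s"
    and shift: "N (a - x) = s" "N (b - x) \<le> s" "N (c - x) \<le> s"
    and neg: "\<delta>\<^sub>2 < 0"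
  shows "0 < \<delta>\<^sub>3"
proof (rule ccontr)
  assume "\<not> 0 < \<delta>\<^sub>3"
  then have neg3: "\<delta>\<^sub>3 \<le> 0" by simp
  obtain w where wax: "w \<bullet> (a - x) = s" and w: "\<And>y. w \<bullet> y \<le> N y"
    using supporting_functional[OF N, of "a - x"] shift(1) by metis
  have wa: "w \<bullet> a \<le> r" using w a order_trans by blast
  have wx: "w \<bullet> x = w \<bullet> a - s" using wax by (simp add: inner_diff_right)
  have "w \<bullet> (b - x) \<le> s" "w \<bullet> (c - x) \<le> s" using w shift order_trans by blast+
  then have wb: "w \<bullet> b \<le> w \<bullet> a" and wc: "w \<bullet> c \<le> w \<bullet> a"
    using wx by (simp_all add: inner_diff_right)
  have "w \<bullet> a - s = (\<delta>\<^sub>1 + \<delta>\<^sub>2 + \<delta>\<^sub>3) * (w \<bullet> a) + \<delta>\<^sub>2 * (w \<bullet> b - w \<bullet> a) + \<delta>\<^sub>3 * (w \<bullet> c - w \<bullet> a)"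
    unfolding wx[symmetric] x(1) by (simp add: inner_add_right algebra_simps)
  moreover have "\<delta>\<^sub>1 + \<delta>\<^sub>2 + \<delta>\<^sub>3 = 1 - s / r" using x(2) r by (simp add: field_simps)
  ultimately have "w \<bullet> a - s
      = (1 - s / r) * (w \<bullet> a) + \<delta>\<^sub>2 * (w \<bullet> b - w \<bullet> a) + \<delta>\<^sub>3 * (w \<bullet> c - w \<bullet> a)"
    by simp
  \<comment> \<open>The two sides have opposite signs: the left is nonpositive as
    \<open>w \<bullet> a \<le> r\<close>, the right is nonnegative. So every term vanishes, and
    \<open>\<delta>\<^sub>2 < 0\<close> puts both \<open>a\<close> and \<open>b\<close> on the level
    \<open>r\<close> of \<open>w\<close>.\<close>
  then have eq: "s * (w \<bullet> a / r - 1) = \<delta>\<^sub>2 * (w \<bullet> b - w \<bullet> a) + \<delta>\<^sub>3 * (w \<bullet> c - w \<bullet> a)"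
    by (simp add: algebra_simps)
  have "0 \<le> \<delta>\<^sub>2 * (w \<bullet> b - w \<bullet> a)" "0 \<le> \<delta>\<^sub>3 * (w \<bullet> c - w \<bullet> a)"
    using neg neg3 wb wc by (simp_all add: mult_nonpos_nonpos)
  moreover have "s * (w \<bullet> a / r - 1) \<le> 0"
    using s r wa by (simp add: mult_le_0_iff)
  ultimately have "s * (w \<bullet> a / r - 1) = 0" "\<delta>\<^sub>2 * (w \<bullet> b - w \<bullet> a) = 0"
    using eq by linarith+
  then have "w \<bullet> a = r" "w \<bullet> b = r" using s r neg by auto
  then show False
    using support_at_most_one_vertex[OF N r c bary w] by blast
qed

lemma shift_zero:
  fixes N :: "'a::euclidean_space \<Rightarrow> real"
  assumes N: "is_norm N" and r: "0 < r" and s: "0 < s" and abc: "N a = r" "N b = r" "N c = r"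
    and bary: "\<alpha> *\<^sub>R a + \<beta> *\<^sub>R b + \<gamma> *\<^sub>R c = 0" "\<alpha> + \<beta> + \<gamma> = 1"
      "0 < \<alpha>" "\<alpha> < 1/2" "0 < \<beta>" "\<beta> < 1/2" "0 < \<gamma>" "\<gamma> < 1/2"
    and x: "x = \<delta>\<^sub>1 *\<^sub>R a + \<delta>\<^sub>2 *\<^sub>R b + \<delta>\<^sub>3 *\<^sub>R c" "(\<delta>\<^sub>1 + \<delta>\<^sub>2 + \<delta>\<^sub>3) * r = r - s"
    and shift: "N (a - x) = s" "N (b - x) = s" "N (c - x) = s"
  shows "x = 0"
proof -
  \<comment> \<open>The preceding lemmas single out the first vertex, and the shifted one also tells
    the second from the third. Hence rotations and transpositions of both relations are
    needed.\<close>
  have bary': "\<beta> *\<^sub>R b + \<gamma> *\<^sub>R c + \<alpha> *\<^sub>R a = 0" "\<beta> + \<gamma> + \<alpha> = 1"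
      "\<gamma> *\<^sub>R c + \<alpha> *\<^sub>R a + \<beta> *\<^sub>R b = 0" "\<gamma> + \<alpha> + \<beta> = 1"
      "\<alpha> *\<^sub>R a + \<gamma> *\<^sub>R c + \<beta> *\<^sub>R b = 0" "\<alpha> + \<gamma> + \<beta> = 1"
      "\<beta> *\<^sub>R b + \<alpha> *\<^sub>R a + \<gamma> *\<^sub>R c = 0" "\<beta> + \<alpha> + \<gamma> = 1"
    using bary(1,2) by (simp_all add: add_ac)
  have x': "x = \<delta>\<^sub>2 *\<^sub>R b + \<delta>\<^sub>3 *\<^sub>R c + \<delta>\<^sub>1 *\<^sub>R a" "(\<delta>\<^sub>2 + \<delta>\<^sub>3 + \<delta>\<^sub>1) * r = r - s"
      "x = \<delta>\<^sub>3 *\<^sub>R c + \<delta>\<^sub>1 *\<^sub>R a + \<delta>\<^sub>2 *\<^sub>R b" "(\<delta>\<^sub>3 + \<delta>\<^sub>1 + \<delta>\<^sub>2) * r = r - s"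
      "x = \<delta>\<^sub>1 *\<^sub>R a + \<delta>\<^sub>3 *\<^sub>R c + \<delta>\<^sub>2 *\<^sub>R b" "(\<delta>\<^sub>1 + \<delta>\<^sub>3 + \<delta>\<^sub>2) * r = r - s"
      "x = \<delta>\<^sub>2 *\<^sub>R b + \<delta>\<^sub>1 *\<^sub>R a + \<delta>\<^sub>3 *\<^sub>R c" "(\<delta>\<^sub>2 + \<delta>\<^sub>1 + \<delta>\<^sub>3) * r = r - s"
    using x by (simp_all add: add_ac)
  note le = abc[THEN eq_refl] shift[THEN eq_refl]
  note vertex = support_at_vertex[OF N r]
  have pos: "0 \<le> \<delta>\<^sub>2 \<Longrightarrow> 0 \<le> \<delta>\<^sub>3 \<Longrightarrow> \<delta>\<^sub>2 = 0 \<and> \<delta>\<^sub>3 = 0"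
      "0 \<le> \<delta>\<^sub>3 \<Longrightarrow> 0 \<le> \<delta>\<^sub>1 \<Longrightarrow> \<delta>\<^sub>3 = 0 \<and> \<delta>\<^sub>1 = 0"
      "0 \<le> \<delta>\<^sub>1 \<Longrightarrow> 0 \<le> \<delta>\<^sub>2 \<Longrightarrow> \<delta>\<^sub>1 = 0 \<and> \<delta>\<^sub>2 = 0"
    using vertex[OF abc(1,2,3) bary(1,2) bary(5-8) x(1,2) le(4)]
      vertex[OF abc(2,3,1) bary'(1,2) bary(7,8) bary(3,4) x'(1,2) le(5)]
      vertex[OF abc(3,1,2) bary'(3,4) bary(3-6) x'(3,4) le(6)] by blast+
  note shifted = support_at_shifted_vertex[OF N r s]
  have neg: "\<delta>\<^sub>2 < 0 \<Longrightarrow> 0 < \<delta>\<^sub>3" "\<delta>\<^sub>3 < 0 \<Longrightarrow> 0 < \<delta>\<^sub>2"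
      "\<delta>\<^sub>3 < 0 \<Longrightarrow> 0 < \<delta>\<^sub>1" "\<delta>\<^sub>1 < 0 \<Longrightarrow> 0 < \<delta>\<^sub>3" "\<delta>\<^sub>1 < 0 \<Longrightarrow> 0 < \<delta>\<^sub>2"
    using shifted[OF le(1,3) bary(1,2) bary(7,8) x(1,2) shift(1) le(5,6)]
      shifted[OF le(1,2) bary'(5,6) bary(5,6) x'(5,6) shift(1) le(6,5)]
      shifted[OF le(2,1) bary'(1,2) bary(3,4) x'(1,2) shift(2) le(6,4)]
      shifted[OF le(2,3) bary'(7,8) bary(7,8) x'(7,8) shift(2) le(4,6)]
      shifted[OF le(3,2) bary'(3,4) bary(5,6) x'(3,4) shift(3) le(4,5)] by blast+
  \<comment> \<open>No coefficient is negative: by \<open>neg\<close> the other two would be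
    nonnegative and not both zero, against \<open>pos\<close>. With all three nonnegative,
    \<open>pos\<close> makes them vanish.\<close>
  have "\<delta>\<^sub>1 = 0 \<and> \<delta>\<^sub>2 = 0 \<and> \<delta>\<^sub>3 = 0" using pos neg by (smt (verit))
  then show ?thesis using x(1) by simp
qed

lemma affine_hull_noncollinear:
  fixes a b c :: "'a::euclidean_space"
  assumes "\<not> collinear {a, b, c}" and "DIM('a) = 2"
  shows "affine hull {a, b, c} = UNIV"
proof (rule affine_independent_span_eq)
  show "\<not> affine_dependent {a, b, c}"
    using assms(1) by (simp add: collinear_3_eq_affine_dependent)
  show "card {a, b, c} = Suc DIM('a)"
    using assms by (auto simp: collinear_3_eq_affine_dependent)
qed

lemma barycentric_coordinates:
  assumes "is_triangle A B C"
  obtains u v w where "u + v + w = 1" and "X = u *\<^sub>R A + v *\<^sub>R B + w *\<^sub>R C"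
proof -
  have "X \<in> affine hull {A, B, C}"
    using assms by (simp add: is_triangle_def affine_hull_noncollinear)
  then show ?thesis using that by (auto simp: affine_hull_3)
qed

text \<open>Assuming weights instead of membership in the medial triangle serves both claims: the
  centroid enters directly with weights 1/3.\<close>

lemma circumcenter_unique:
  assumes N: "is_norm N" and T: "is_triangle A B C"
    and M: "is_circumcenter N A B C M" and M': "is_circumcenter N A B C M'"
    and bary: "M = \<alpha> *\<^sub>R A + \<beta> *\<^sub>R B + \<gamma> *\<^sub>R C" "\<alpha> + \<beta> + \<gamma> = 1"
      "0 < \<alpha>" "\<alpha> < 1/2" "0 < \<beta>" "\<beta> < 1/2" "0 < \<gamma>" "\<gamma> < 1/2"
  shows "M' = M"
proof -
  obtain r where r: "0 < r" and abc: "N (A - M) = r" "N (B - M) = r" "N (C - M) = r"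
    using M by (auto simp: is_circumcenter_def mcircle_def)
  obtain s where s: "0 < s" and abc': "N (A - M') = s" "N (B - M') = s" "N (C - M') = s"
    using M' by (auto simp: is_circumcenter_def mcircle_def)
  obtain u v w where uvw: "u + v + w = 1" "M' = u *\<^sub>R A + v *\<^sub>R B + w *\<^sub>R C"
    using barycentric_coordinates[OF T] .
  have zero: "\<alpha> *\<^sub>R (A - M) + \<beta> *\<^sub>R (B - M) + \<gamma> *\<^sub>R (C - M) = 0"
  proof -
    have "\<alpha> *\<^sub>R (A - M) + \<beta> *\<^sub>R (B - M) + \<gamma> *\<^sub>R (C - M)
        = (\<alpha> *\<^sub>R A + \<beta> *\<^sub>R B + \<gamma> *\<^sub>R C) - (\<alpha> + \<beta> + \<gamma>) *\<^sub>R M" by (simp add: algebra_simps)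
    then show ?thesis using bary(1,2) by simp
  qed
  \<comment> \<open>Adding \<open>k\<close> times the vanishing combination \<open>zero\<close>
    leaves \<open>M' - M\<close> unchanged and moves the coefficient sum from 1 to
    \<open>1 + k\<close>, which is the required \<open>(r - s) / r\<close>.\<close>
  define k where "k = (r - s) / r - 1"
  have "M' - M = u *\<^sub>R (A - M) + v *\<^sub>R (B - M) + w *\<^sub>R (C - M)"
  proof -
    have "u *\<^sub>R (A - M) + v *\<^sub>R (B - M) + w *\<^sub>R (C - M) = M' - (u + v + w) *\<^sub>R M"
      by (simp add: uvw(2) algebra_simps)
    then show ?thesis using uvw(1) by simp
  qed
  also have "\<dots> = \<dots> + k *\<^sub>R (\<alpha> *\<^sub>R (A - M) + \<beta> *\<^sub>R (B - M) + \<gamma> *\<^sub>R (C - M))"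
    by (simp add: zero)
  also have "\<dots> = (u + k * \<alpha>) *\<^sub>R (A - M) + (v + k * \<beta>) *\<^sub>R (B - M) + (w + k * \<gamma>) *\<^sub>R (C - M)"
    by (simp only: scaleR_add_left scaleR_add_right scaleR_scaleR add_ac)
  finally have x: "M' - M = \<dots>" .
  have "(u + k * \<alpha>) + (v + k * \<beta>) + (w + k * \<gamma>) = (u + v + w) + k * (\<alpha> + \<beta> + \<gamma>)"
    by (simp add: algebra_simps)
  then have sum: "((u + k * \<alpha>) + (v + k * \<beta>) + (w + k * \<gamma>)) * r = r - s"
    using r by (simp add: uvw(1) bary(2) k_def)
  have "M' - M = 0"
    by (rule shift_zero[OF N r s abc zero bary(2-8) x sum]) (simp_all add: abc')
  then show ?thesis by simp
qed

lemma rel_interior_medial_triangle: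
  assumes T: "is_triangle A B C" and M: "M \<in> rel_interior (medial_triangle A B C)"
  obtains \<alpha> \<beta> \<gamma> where "M = \<alpha> *\<^sub>R A + \<beta> *\<^sub>R B + \<gamma> *\<^sub>R C" and "\<alpha> + \<beta> + \<gamma> = 1"
    and "0 < \<alpha>" "\<alpha> < 1/2" "0 < \<beta>" "\<beta> < 1/2" "0 < \<gamma>" "\<gamma> < 1/2"
proof -
  let ?P = "midpoint B C" and ?Q = "midpoint C A" and ?R = "midpoint A B"
  have nc: "\<not> collinear {?P, ?Q, ?R}"
  proof
    assume "collinear {?P, ?Q, ?R}"
    then obtain u where u: "\<forall>x\<in>{?P, ?Q, ?R}. \<forall>y\<in>{?P, ?Q, ?R}. \<exists>c. x - y = c *\<^sub>R u"
      unfolding collinear_def by blast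
    have "\<exists>c. X - Y = c *\<^sub>R u" if "X \<in> {A, B, C}" "Y \<in> {A, B, C}" for X Y
    proof -
      \<comment> \<open>Each side of the triangle is twice a side of the medial one, for instance
        \<open>A - B = 2 *\<^sub>R (?Q - ?P)\<close>.\<close>
      have "\<exists>p\<in>{?P, ?Q, ?R}. \<exists>q\<in>{?P, ?Q, ?R}. X - Y = 2 *\<^sub>R (p - q)"
        using that by (auto simp: midpoint_def algebra_simps)
      then obtain p q c where "X - Y = 2 *\<^sub>R (p - q)" "p - q = c *\<^sub>R u" using u by blast
      then show ?thesis by (metis scaleR_scaleR)
    qed
    then have "collinear {A, B, C}" unfolding collinear_def by blast
    then show False using T by (simp add: is_triangle_def)
  qed
  \<comment> \<open>The midpoints span the plane affinely, so relative interior and interior agree,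
    and interior points have strictly positive weights.\<close>
  then have "interior (convex hull {?P, ?Q, ?R}) = rel_interior (convex hull {?P, ?Q, ?R})"
    by (simp add: rel_interior_interior affine_hull_noncollinear)
  then have "M \<in> interior (convex hull {?P, ?Q, ?R})"
    using M by (simp add: medial_triangle_def)
  then obtain x y z where xyz: "0 < x" "0 < y" "0 < z" "x + y + z = 1"
    and M_eq: "x *\<^sub>R ?P + y *\<^sub>R ?Q + z *\<^sub>R ?R = M"
    using nc by (auto simp: interior_convex_hull_3_minimal)
  show ?thesis
  \<comment> \<open>\<open>A\<close> is an endpoint for \<open>?Q\<close> and \<open>?R\<close>
    only, so its weight is \<open>(y + z) / 2 = (1 - x) / 2\<close>; the bound 1/2 is exactly
    \<open>0 < x\<close>.\<close>
  proof (rule that[of "(y + z) / 2" "(x + z) / 2" "(x + y) / 2"])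
    show "M = ((y + z) / 2) *\<^sub>R A + ((x + z) / 2) *\<^sub>R B + ((x + y) / 2) *\<^sub>R C"
      unfolding M_eq[symmetric] midpoint_def by (simp add: algebra_simps add_divide_distrib)
  qed (use xyz in \<open>simp_all add: field_simps\<close>)
qed

theorem theorem2p3:
  fixes N :: "real^2 \<Rightarrow> real" and A B C :: "real^2"
  assumes "is_norm N" and "is_triangle A B C"
  shows "(\<forall>M. is_circumcenter N A B C M \<and> M \<in> rel_interior (medial_triangle A B C)
            \<longrightarrow> (\<forall>M'. is_circumcenter N A B C M' \<longrightarrow> M' = M))
       \<and> (is_circumcenter N A B C (centroid A B C)
            \<longrightarrow> (\<forall>M'. is_circumcenter N A B C M' \<longrightarrow> M' = centroid A B C))"
proof (intro conjI allI impI)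
  fix M M'
  assume M: "is_circumcenter N A B C M \<and> M \<in> rel_interior (medial_triangle A B C)"
    and M': "is_circumcenter N A B C M'"
  obtain \<alpha> \<beta> \<gamma> where "M = \<alpha> *\<^sub>R A + \<beta> *\<^sub>R B + \<gamma> *\<^sub>R C" "\<alpha> + \<beta> + \<gamma> = 1"
    "0 < \<alpha>" "\<alpha> < 1/2" "0 < \<beta>" "\<beta> < 1/2" "0 < \<gamma>" "\<gamma> < 1/2"
    using rel_interior_medial_triangle[OF assms(2) conjunct2[OF M]] .
  then show "M' = M"
    by (rule circumcenter_unique[OF assms conjunct1[OF M] M'])
next
  fix M'
  assume "is_circumcenter N A B C (centroid A B C)" and "is_circumcenter N A B C M'"
  then show "M' = centroid A B C"
    by (rule circumcenter_unique[OF assms, where \<alpha> = "1/3" and \<beta> = "1/3" and \<gamma> = "1/3"])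
       (simp_all add: centroid_def scaleR_add_right)
qed

end
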